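(* Let $R_4(n)$ be the number of partitions of $n$ with max-rook number $4$. For every integer $n>16$, written as $n=12m+a$ with $m$ an integer and $0\le a\le 11$, we have $$R_4(n)=\begin{cases} 192m^3-264m^2+87m-3, & \text{if } a=0,\\ 192m^3-216m^2+44m+5, & \text{if } a=1,\\ 192m^3-168m^2+15m+5, & \text{if } a=2,\\ 192m^3-120m^2-12m+7, & \text{if } a=3,\\ 192m^3-72m^2-25m+4, & \text{if } a=4,\\ 192m^3-24m^2-36m+3, & \text{if } a=5,\\ 192m^3+24m^2-33m-2, & \text{if } a=6,\\ 192m^3+72m^2-28m-3, & \text{if } a=7,\\ 192m^3+120m^2-9m-5, & \text{if } a=8,\\ 192m^3+168m^2+12m-5, & \text{if } a=9,\\ 192m^3+216m^2+47m-3, & \text{if } a=10,\\ 192m^3+264m^2+84m+3, & \text{if } a=11. \end{cases}$$ Further, for any fixed integer $p\ge 2$, $R_4(n)\bmod p$ is periodic in $n$ for $n>16$ with period $12p$, i.e. for all $n>16$, $$R_4(n+12p)\equiv R_4(n)\pmod p.$$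
   Context: A partition $\pi$ of a positive integer $n$ is a non-increasing sequence of positive integers $(\lambda_1,\dots,\lambda_r)$ with sum $n$; $\mathscr{P}(n)$ is the set of all partitions of $n$. The Ferrers board $B_\pi$ of $\pi=(\lambda_1,\dots,\lambda_r)$ is the left-justified array of unit squares with $r$ rows whose $i$-th row from the top has $\lambda_i$ squares. Rooks placed on squares of the board are non-intersecting if no two of them lie in the same row or the same column. The max-rook number $R(\pi)$ is the maximal number of non-intersecting rooks that can be placed in $B_\pi$. For positive integers $n,k$, $R_k(n):=\#\{\pi\in\mathscr{P}(n) : R(\pi)=k\}$. "Periodic with period $12p$" means exactly the displayed congruence (minimality of the period is not asserted). *)

theory Defs
  imports Main "HOL-Number_Theory.Cong"
begin

definition partitions :: "nat \<Rightarrow> nat list set" where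
  "partitions n = {ls. sorted_wrt (\<ge>) ls \<and> (\<forall>l \<in> set ls. 0 < l) \<and> sum_list ls = n}"

(* A square is a pair (row, column); rows and columns are counted from 0. *)

definition ferrers_board :: "nat list \<Rightarrow> (nat \<times> nat) set" where
  "ferrers_board ls = {(i, j). i < length ls \<and> j < ls ! i}"

definition non_intersecting :: "(nat \<times> nat) set \<Rightarrow> bool" where
  "non_intersecting S \<longleftrightarrow>
     (\<forall>s \<in> S. \<forall>t \<in> S. s \<noteq> t \<longrightarrow> fst s \<noteq> fst t \<and> snd s \<noteq> snd t)"

(* The board is finite and the empty placement is admissible, so the maximum is attained. *)

definition max_rook :: "nat list \<Rightarrow> nat" where
  "max_rook ls = Max {card S |S. S \<subseteq> ferrers_board ls \<and> non_intersecting S}"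

definition rook_count :: "nat \<Rightarrow> nat \<Rightarrow> nat" where
  "rook_count k n = card {ls \<in> partitions n. max_rook ls = k}"

end

theory Submission
  imports Defs "HOL-Library.Disjoint_Sets" "HOL-Computational_Algebra.Formal_Power_Series"
begin

text \<open>A board carries \<open>k\<close> non-intersecting rooks if and only if it contains the staircase
  \<open>(k, k - 1, \<dots>, 1)\<close>, so \<open>R(\<pi>) = k\<close> means that the staircase of size \<open>k\<close>
  fits into \<open>\<pi>\<close> and the one of size \<open>k + 1\<close> does not (\<open>max_rook_eq_iff\<close>).
  In that case there is a row \<open>i \<le> k\<close>, counted from 0, with \<open>i + \<lambda>\<^sub>i = k\<close> (where \<open>\<lambda>\<^sub>i = 0\<close> below the board); call
  the first such row critical. Every row above it satisfies \<open>j + \<lambda>\<^sub>j > k\<close>. Cutting at the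
  critical row removes a rectangle of \<open>i\<close> rows and \<open>k + 1 - i\<close> columns and leaves
  two independent pieces: to its right, \<open>i\<close> rows that contain the staircase of size \<open>i\<close>;
  below it, a partition with parts at most \<open>k - i\<close> that contains the staircase of size
  \<open>k - i\<close>. This is the product formula \<open>gf_rook_set\<close>.

  Let \<open>q\<close> be the indeterminate. For both kinds of pieces the generating functions
  \<open>G a b\<close> (at most \<open>a\<close> rows, respectively parts at most \<open>a\<close>, and a staircase of size \<open>b\<close>) satisfy
  \<open>G (a + 1) b = G a b + q\<^bsup>a + 1\<^esup> G (a + 1) (b - 1)\<close>, by splitting off one full column or
  row. Hence \<open>(1 - q) \<dots> (1 - q\<^bsup>a\<^esup>) G a b\<close> is the same explicit polynomial
  \<open>stair_num a b\<close> in both cases (\<open>stair_num_unique\<close>).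

  For \<open>k = 4\<close> it follows that \<open>(1 - q)(1 - q\<^sup>2)(1 - q\<^sup>3)(1 - q\<^sup>4) \<Sum>\<^sub>n R\<^sub>4(n) q\<^sup>n\<close>
  is a polynomial of degree 26 (\<open>gf_rook_set_4\<close>). So \<open>R\<^sub>4\<close> satisfies a linear recurrence of
  order 10 from \<open>n = 27\<close> on. The claimed quasi-polynomial satisfies the same recurrence
  and has the same values for \<open>17 \<le> n \<le> 26\<close>, so both agree for all \<open>n > 16\<close>. The
  congruence holds because \<open>n \<mapsto> n + 12 p\<close> keeps the residue modulo 12 and replaces
  \<open>m\<close> by \<open>m + p\<close> in a polynomial with integer coefficients.\<close>

unbundle fps_syntax

section \<open>Max-rook number and staircases\<close>

text \<open>The length of row \<open>i\<close>, which is 0 below the last row.\<close>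

definition row :: "nat list \<Rightarrow> nat \<Rightarrow> nat" where
  "row ls i = (if i < length ls then ls ! i else 0)"

text \<open>The Ferrers board of \<open>ls\<close> contains the board of \<open>(k, k - 1, \<dots>, 1)\<close>: row
  \<open>i < k\<close> has at least \<open>k - i\<close> squares. The inequality is written without
  subtraction.\<close>

definition staircase :: "nat \<Rightarrow> nat list \<Rightarrow> bool" where
  "staircase k ls \<longleftrightarrow> (\<forall>i<k. k \<le> i + row ls i)"

lemma row_Cons: "row (x # xs) i = (case i of 0 \<Rightarrow> x | Suc j \<Rightarrow> row xs j)"
  by (cases i) (auto simp: row_def)

lemma row_append: "row (xs @ ys) i = (if i < length xs then xs ! i else row ys (i - length xs))"
  by (auto simp: row_def nth_append)

lemma row_antimono:
  assumes "sorted_wrt (\<ge>) ls" "i \<le> j"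
  shows "row ls j \<le> row ls i"
  using assms by (cases "i = j") (auto simp: row_def sorted_wrt_iff_nth_less)

lemma staircase_0 [simp]: "staircase 0 ls"
  by (simp add: staircase_def)

lemma staircase_Cons: "staircase (Suc k) (x # xs) \<longleftrightarrow> Suc k \<le> x \<and> staircase k xs"
proof -
  have "(\<forall>i<Suc k. Suc k \<le> i + row (x # xs) i) \<longleftrightarrow>
      Suc k \<le> x \<and> (\<forall>i<k. Suc k \<le> Suc i + row xs i)"
    by (subst All_less_Suc2) (simp add: row_Cons)
  then show ?thesis by (simp add: staircase_def)
qed

lemma staircase_length: "staircase k ls \<Longrightarrow> k \<le> length ls"
proof (rule ccontr)
  assume "staircase k ls" "\<not> k \<le> length ls"
  then have "k \<le> length ls + row ls (length ls)" by (auto simp: staircase_def)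
  with \<open>\<not> k \<le> length ls\<close> show False by (simp add: row_def)
qed

lemma staircase_mono: "staircase k ls \<Longrightarrow> j \<le> k \<Longrightarrow> staircase j ls"
  unfolding staircase_def by (meson less_le_trans order_trans)

lemma finite_ferrers_board: "finite (ferrers_board ls)"
proof -
  have "ferrers_board ls = (SIGMA i:{..<length ls}. {..<ls ! i})"
    by (auto simp: ferrers_board_def)
  then show ?thesis by simp
qed

lemma staircase_rooks:
  assumes "staircase k ls"
  shows "\<exists>S \<subseteq> ferrers_board ls. non_intersecting S \<and> card S = k"
proof (intro exI conjI)
  \<comment> \<open>The rooks stand on the antidiagonal that bounds the staircase.\<close>
  let ?S = "(\<lambda>i. (i, k - Suc i)) ` {..<k}"
  show "?S \<subseteq> ferrers_board ls"
  proof clarify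
    fix i assume "i < k"
    then have "i < length ls" "k \<le> i + row ls i"
      using assms staircase_length[OF assms] by (auto simp: staircase_def)
    with \<open>i < k\<close> show "(i, k - Suc i) \<in> ferrers_board ls"
      by (simp add: ferrers_board_def row_def)
  qed
  show "non_intersecting ?S" by (auto simp: non_intersecting_def)
  show "card ?S = k" by (subst card_image) (auto simp: inj_on_def)
qed

text \<open>The easy half of Koenig's theorem: at most \<open>i\<close> rooks of a placement lie in the first
  \<open>i\<close> rows, and the others occupy distinct columns among the first \<open>row ls i\<close>.\<close>

lemma rooks_staircase:
  assumes "sorted_wrt (\<ge>) ls" "S \<subseteq> ferrers_board ls" "non_intersecting S"
  shows "staircase (card S) ls"
  unfolding staircase_def
proof (intro allI impI)
  fix i
  let ?A = "{s \<in> S. fst s < i}" and ?B = "{s \<in> S. i \<le> fst s}"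
  have fin: "finite S" using assms(2) finite_ferrers_board finite_subset by blast
  have inj: "inj_on fst S" "inj_on snd S"
    using assms(3) by (auto simp: non_intersecting_def inj_on_def)
  have "card ?A \<le> card {..<i}"
    by (rule card_inj_on_le[where f = fst]) (auto intro: inj_on_subset[OF inj(1)])
  moreover have "card ?B \<le> card {..<row ls i}"
  proof (rule card_inj_on_le[where f = snd])
    show "snd ` ?B \<subseteq> {..<row ls i}"
    proof clarsimp
      fix a b assume "(a, b) \<in> S" "i \<le> a"
      then have "b < row ls a" using assms(2) by (auto simp: ferrers_board_def row_def)
      with row_antimono[OF assms(1) \<open>i \<le> a\<close>] show "b < row ls i" by simp
    qed
  qed (auto intro: inj_on_subset[OF inj(2)])
  moreover have "card S = card ?A + card ?B"
  proof -
    have "card (?A \<union> ?B) = card ?A + card ?B"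
      using fin by (intro card_Un_disjoint) auto
    moreover have "?A \<union> ?B = S" by auto
    ultimately show ?thesis by simp
  qed
  ultimately show "card S \<le> i + row ls i" by simp
qed

lemma max_rook_eq_iff:
  assumes "sorted_wrt (\<ge>) ls"
  shows "max_rook ls = k \<longleftrightarrow> staircase k ls \<and> \<not> staircase (Suc k) ls"
proof -
  let ?C = "{card S |S. S \<subseteq> ferrers_board ls \<and> non_intersecting S}"
  have C: "?C = {k. staircase k ls}"
    using staircase_rooks rooks_staircase[OF assms] by blast
  have "finite {k. staircase k ls}"
    by (rule finite_subset[of _ "{..length ls}"]) (auto dest: staircase_length)
  moreover have "{k. staircase k ls} \<noteq> {}" using staircase_0 by blast
  ultimately have "max_rook ls = k \<longleftrightarrow> staircase k ls \<and> (\<forall>j. staircase j ls \<longrightarrow> j \<le> k)"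
    unfolding max_rook_def C by (subst Max_eq_iff) auto
  also have "(\<forall>j. staircase j ls \<longrightarrow> j \<le> k) \<longleftrightarrow> \<not> staircase (Suc k) ls"
    by (meson Suc_n_not_le_n not_less_eq_eq staircase_mono)
  finally show ?thesis .
qed


section \<open>Generating functions of weighted sets\<close>

text \<open>The generating function of a set whose elements have weights in \<open>nat\<close>. It is
  meaningful only if each weight occurs finitely often, which is the predicate
  \<open>fin_weight\<close>.\<close>

definition gf :: "('a \<Rightarrow> nat) \<Rightarrow> 'a set \<Rightarrow> int fps" where
  "gf w S = Abs_fps (\<lambda>n. int (card {x \<in> S. w x = n}))"

definition fin_weight :: "('a \<Rightarrow> nat) \<Rightarrow> 'a set \<Rightarrow> bool" where
  "fin_weight w S \<longleftrightarrow> (\<forall>n. finite {x \<in> S. w x = n})"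

lemma gf_nth: "gf w S $ n = int (card {x \<in> S. w x = n})"
  by (simp add: gf_def)

lemma gf_empty [simp]: "gf w {} = 0"
  by (simp add: fps_eq_iff gf_nth)

lemma fin_weight_subset: "fin_weight w T \<Longrightarrow> S \<subseteq> T \<Longrightarrow> fin_weight w S"
  unfolding fin_weight_def by (rule allI, rule finite_subset[of _ "{x \<in> T. w x = n}" for n]) auto

lemma gf_Un_disjoint:
  assumes "fin_weight w (S \<union> T)" "S \<inter> T = {}"
  shows "gf w (S \<union> T) = gf w S + gf w T"
proof (rule fps_ext)
  fix n
  have "{x \<in> S \<union> T. w x = n} = {x \<in> S. w x = n} \<union> {x \<in> T. w x = n}" by auto
  moreover have "finite {x \<in> S \<union> T. w x = n}" using assms(1) by (simp add: fin_weight_def)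
  moreover have "{x \<in> S. w x = n} \<inter> {x \<in> T. w x = n} = {}" using assms(2) by auto
  ultimately show "gf w (S \<union> T) $ n = (gf w S + gf w T) $ n"
    by (simp add: gf_nth card_Un_disjoint)
qed

lemma gf_UN_disjoint:
  assumes "finite I" "fin_weight w (\<Union>i\<in>I. A i)" "disjoint_family_on A I"
  shows "gf w (\<Union>i\<in>I. A i) = (\<Sum>i\<in>I. gf w (A i))"
  using assms
proof (induction I rule: finite_induct)
  case (insert i I)
  have "gf w (A i \<union> (\<Union>j\<in>I. A j)) = gf w (A i) + gf w (\<Union>j\<in>I. A j)"
    using insert.prems insert.hyps
    by (intro gf_Un_disjoint) (auto simp: disjoint_family_on_def)
  moreover have "gf w (\<Union>j\<in>I. A j) = (\<Sum>j\<in>I. gf w (A j))"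
    using insert.prems
    by (intro insert.IH) (auto simp: disjoint_family_on_def elim: fin_weight_subset)
  ultimately show ?case using insert.hyps by simp
qed simp

lemma gf_image:
  assumes "inj_on f S" "\<And>x. x \<in> S \<Longrightarrow> w (f x) = v x + c"
  shows "gf w (f ` S) = fps_X ^ c * gf v S"
proof (rule fps_ext)
  fix n
  have "{y \<in> f ` S. w y = n} = f ` {x \<in> S. v x + c = n}" using assms(2) by auto
  moreover have "inj_on f {x \<in> S. v x + c = n}" by (rule inj_on_subset[OF assms(1)]) auto
  ultimately have "card {y \<in> f ` S. w y = n} = card {x \<in> S. v x + c = n}"
    by (simp add: card_image)
  also have "{x \<in> S. v x + c = n} = (if n < c then {} else {x \<in> S. v x = n - c})" by auto
  finally show "gf w (f ` S) $ n = (fps_X ^ c * gf v S) $ n"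
    by (simp add: gf_nth fps_X_power_mult_nth)
qed

lemma gf_Times:
  assumes "fin_weight w S" "fin_weight v T"
  shows "gf (\<lambda>(x, y). w x + v y) (S \<times> T) = gf w S * gf v T"
proof (rule fps_ext)
  fix n
  let ?P = "\<lambda>i. {x \<in> S. w x = i} \<times> {y \<in> T. v y = n - i}"
  have "{z \<in> S \<times> T. (\<lambda>(x, y). w x + v y) z = n} = (\<Union>i\<in>{0..n}. ?P i)" by auto
  also have "card \<dots> = (\<Sum>i\<in>{0..n}. card (?P i))"
    using assms by (intro card_UN_disjoint) (auto simp: fin_weight_def)
  finally show "gf (\<lambda>(x, y). w x + v y) (S \<times> T) $ n = (gf w S * gf v T) $ n"
    by (simp add: gf_nth fps_mult_nth card_cartesian_product)
qed


section \<open>The two families of partitions in the decomposition\<close>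

text \<open>The upper pieces: partitions with at most \<open>a\<close> parts, filled up with zeros to length
  exactly \<open>a\<close>, that contain the staircase of size \<open>b\<close>.\<close>

definition padded :: "nat \<Rightarrow> nat \<Rightarrow> nat list set" where
  "padded a b = {xs. length xs = a \<and> sorted_wrt (\<ge>) xs \<and> staircase b xs}"

text \<open>The lower pieces: partitions with parts at most \<open>a\<close> that contain the staircase of size
  \<open>b\<close>. They are the conjugates of the partitions in \<open>padded a b\<close>, but treating them
  separately avoids conjugation.\<close>

definition bounded :: "nat \<Rightarrow> nat \<Rightarrow> nat list set" where
  "bounded a b = {xs. sorted_wrt (\<ge>) xs \<and> (\<forall>x\<in>set xs. 0 < x \<and> x \<le> a) \<and> staircase b xs}"

lemma finite_partitions: "finite (partitions n)"
proof (rule finite_subset)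
  have "length xs \<le> sum_list xs" if "\<forall>x\<in>set xs. 0 < x" for xs :: "nat list"
    using that by (induction xs) auto
  then show "partitions n \<subseteq> {xs. set xs \<subseteq> {..n} \<and> length xs \<le> n}"
    by (auto simp: partitions_def member_le_sum_list)
  show "finite {xs. set xs \<subseteq> {..n} \<and> length xs \<le> n}"
    by (rule finite_lists_length_le) simp
qed

lemma fin_weight_padded: "fin_weight sum_list (padded a b)"
  unfolding fin_weight_def
proof
  fix n
  show "finite {x \<in> padded a b. sum_list x = n}"
    by (rule finite_subset[OF _ finite_lists_length_eq[of "{..n}" a]])
      (auto simp: padded_def member_le_sum_list)
qed

lemma fin_weight_bounded: "fin_weight sum_list (bounded a b)"
  unfolding fin_weight_def
  by (intro allI finite_subset[OF _ finite_partitions])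
    (auto simp: bounded_def partitions_def)

lemma padded_0: "padded 0 0 = {[]}"
  by (auto simp: padded_def)

lemma padded_empty: "a < b \<Longrightarrow> padded a b = {}"
  by (auto simp: padded_def dest: staircase_length)

lemma staircase_map_Suc:
  assumes "b \<le> length xs"
  shows "staircase b (map Suc xs) \<longleftrightarrow> staircase (b - 1) xs"
proof -
  have "row (map Suc xs) i = Suc (row xs i)" if "i < b" for i
    using that assms by (simp add: row_def)
  then have "staircase b (map Suc xs) \<longleftrightarrow> (\<forall>i<b. b - 1 \<le> i + row xs i)"
    by (auto simp: staircase_def)
  also have "\<dots> \<longleftrightarrow> (\<forall>i<b - 1. b - 1 \<le> i + row xs i)"
    by (metis le_add1 le_trans less_imp_diff_less less_le_trans linorder_not_less diff_le_self)
  also have "\<dots> \<longleftrightarrow> staircase (b - 1) xs"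
    by (simp add: staircase_def)
  finally show ?thesis .
qed

lemma staircase_append_0: "staircase b (xs @ [0]) \<longleftrightarrow> staircase b xs"
  by (simp add: staircase_def row_def nth_append)

text \<open>Either the last entry is zero, or the first column is full and can be removed, which takes
  one unit off the staircase.\<close>

lemma padded_Suc:
  assumes "b \<le> Suc a"
  shows "padded (Suc a) b = (\<lambda>xs. xs @ [0]) ` padded a b \<union> map Suc ` padded (Suc a) (b - 1)"
    (is "_ = ?A \<union> ?B")
proof
  show "?A \<union> ?B \<subseteq> padded (Suc a) b"
    using assms
    by (auto simp: padded_def staircase_append_0 staircase_map_Suc sorted_wrt_append sorted_wrt_map)
  show "padded (Suc a) b \<subseteq> ?A \<union> ?B"
  proof
    fix xs assume xs: "xs \<in> padded (Suc a) b"
    then obtain ys y where ys: "xs = ys @ [y]" "length ys = a"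
      by (auto simp: padded_def length_Suc_conv_rev)
    show "xs \<in> ?A \<union> ?B"
    proof (cases "y = 0")
      case True
      then have "ys \<in> padded a b"
        using xs ys by (simp add: padded_def staircase_append_0 sorted_wrt_append)
      with True ys show ?thesis by auto
    next
      case False
      have "\<forall>x\<in>set xs. 0 < x"
        using xs ys False by (auto simp: padded_def sorted_wrt_append)
      then have map: "xs = map Suc (map (\<lambda>x. x - 1) xs)"
        by (simp add: map_idI)
      moreover have "sorted_wrt (\<ge>) (map (\<lambda>x. x - 1) xs)"
        using xs by (auto simp: padded_def sorted_wrt_iff_nth_less diff_le_mono)
      moreover have "staircase (b - 1) (map (\<lambda>x. x - 1) xs)"
        using xs assms map staircase_map_Suc[of b "map (\<lambda>x. x - 1) xs"]
        by (simp add: padded_def)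
      ultimately have "map (\<lambda>x. x - 1) xs \<in> padded (Suc a) (b - 1)"
        using xs by (simp add: padded_def)
      with map show ?thesis by blast
    qed
  qed
qed

lemma gf_padded_Suc:
  assumes "b \<le> Suc a"
  shows "gf sum_list (padded (Suc a) b) =
    gf sum_list (padded a b) + fps_X ^ Suc a * gf sum_list (padded (Suc a) (b - 1))"
proof -
  let ?A = "(\<lambda>xs. xs @ [0]) ` padded a b" and ?B = "map Suc ` padded (Suc a) (b - 1)"
  have "?A \<inter> ?B = {}"
  proof -
    have "0 \<in> set xs" if "xs \<in> ?A" for xs using that by auto
    moreover have "0 \<notin> set xs" if "xs \<in> ?B" for xs using that by auto
    ultimately show ?thesis by blast
  qed
  moreover have "fin_weight sum_list (?A \<union> ?B)"
    unfolding padded_Suc[OF assms, symmetric] by (rule fin_weight_padded)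
  ultimately have "gf sum_list (padded (Suc a) b) = gf sum_list ?A + gf sum_list ?B"
    unfolding padded_Suc[OF assms] by (intro gf_Un_disjoint)
  moreover have "gf sum_list ?A = fps_X ^ 0 * gf sum_list (padded a b)"
    by (rule gf_image) (auto simp: inj_on_def)
  moreover have "gf sum_list ?B = fps_X ^ Suc a * gf sum_list (padded (Suc a) (b - 1))"
  proof (rule gf_image)
    fix xs assume "xs \<in> padded (Suc a) (b - 1)"
    then have "length xs = Suc a" by (simp add: padded_def)
    moreover have "sum_list (map Suc xs) = sum_list xs + length xs" by (induction xs) auto
    ultimately show "sum_list (map Suc xs) = sum_list xs + Suc a" by simp
  qed (auto simp: inj_on_def)
  ultimately show ?thesis by simp
qed

lemma bounded_0: "bounded 0 0 = {[]}"
proof -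
  have "xs = []" if "xs \<in> bounded 0 0" for xs
    using that by (cases xs) (auto simp: bounded_def)
  then show ?thesis by (auto simp: bounded_def)
qed

lemma bounded_empty:
  assumes "a < b"
  shows "bounded a b = {}"
proof -
  have False if xs: "xs \<in> bounded a b" for xs
  proof -
    have "0 < length xs" using xs staircase_length[of b xs] assms by (fastforce simp: bounded_def)
    then have "row xs 0 \<in> set xs" by (simp add: row_def)
    moreover have "b \<le> row xs 0" using xs assms by (auto simp: bounded_def staircase_def)
    ultimately show False using xs assms by (auto simp: bounded_def)
  qed
  then show ?thesis by blast
qed

text \<open>Either no part equals \<open>a + 1\<close>, or the first row has this length and can be removed.
  For \<open>b = 0\<close>, here and in \<open>padded_Suc\<close>, the truncated \<open>b - 1\<close> is the correct
  value \<open>0\<close>.\<close>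

lemma bounded_Suc:
  assumes "b \<le> Suc a"
  shows "bounded (Suc a) b = bounded a b \<union> (#) (Suc a) ` bounded (Suc a) (b - 1)"
    (is "_ = _ \<union> ?B")
proof -
  have stair: "staircase b (Suc a # xs) \<longleftrightarrow> staircase (b - 1) xs" for xs
    using assms by (cases b) (simp_all add: staircase_Cons)
  show ?thesis
  proof
    show "bounded a b \<union> ?B \<subseteq> bounded (Suc a) b"
      by (auto simp: bounded_def stair)
    show "bounded (Suc a) b \<subseteq> bounded a b \<union> ?B"
    proof
      fix xs assume xs: "xs \<in> bounded (Suc a) b"
      show "xs \<in> bounded a b \<union> ?B"
      proof (cases "\<exists>ys. xs = Suc a # ys")
        case True
        then obtain ys where ys: "xs = Suc a # ys" by blast
        then have "ys \<in> bounded (Suc a) (b - 1)" using xs by (auto simp: bounded_def stair)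
        with ys show ?thesis by blast
      next
        case False
        have "\<forall>x\<in>set xs. x \<le> a"
        proof (cases xs)
          case (Cons z zs)
          then have "z \<le> Suc a" "z \<noteq> Suc a" "\<forall>x\<in>set zs. x \<le> z"
            using xs False by (auto simp: bounded_def)
          with Cons show ?thesis by fastforce
        qed simp
        with xs show ?thesis by (auto simp: bounded_def)
      qed
    qed
  qed
qed

lemma gf_bounded_Suc:
  assumes "b \<le> Suc a"
  shows "gf sum_list (bounded (Suc a) b) =
    gf sum_list (bounded a b) + fps_X ^ Suc a * gf sum_list (bounded (Suc a) (b - 1))"
proof -
  let ?B = "(#) (Suc a) ` bounded (Suc a) (b - 1)"
  have "bounded a b \<inter> ?B = {}" by (auto simp: bounded_def)
  moreover have "fin_weight sum_list (bounded a b \<union> ?B)"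
    unfolding bounded_Suc[OF assms, symmetric] by (rule fin_weight_bounded)
  ultimately have "gf sum_list (bounded (Suc a) b) = gf sum_list (bounded a b) + gf sum_list ?B"
    unfolding bounded_Suc[OF assms] by (intro gf_Un_disjoint)
  moreover have "gf sum_list ?B = fps_X ^ Suc a * gf sum_list (bounded (Suc a) (b - 1))"
    by (rule gf_image) (auto simp: inj_on_def)
  ultimately show ?thesis by simp
qed

text \<open>The numerator of the generating function of \<open>padded a b\<close> and of \<open>bounded a b\<close>
  over the denominator \<open>(1 - q) \<dots> (1 - q\<^bsup>a\<^esup>)\<close>. It is a polynomial, encoded as a power
  series.\<close>

fun stair_num :: "nat \<Rightarrow> nat \<Rightarrow> int fps" where
  "stair_num a 0 = 1"
| "stair_num 0 (Suc b) = 0"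
| "stair_num (Suc a) (Suc b) = (if a < b then 0 else
     (1 - fps_X ^ Suc a) * stair_num a (Suc b) + fps_X ^ Suc a * stair_num (Suc a) b)"

lemma stair_num_unique:
  fixes G :: "nat \<Rightarrow> nat \<Rightarrow> int fps"
  assumes zero: "G 0 0 = 1"
    and empty: "\<And>a b. a < b \<Longrightarrow> G a b = 0"
    and Suc: "\<And>a b. b \<le> Suc a \<Longrightarrow> G (Suc a) b = G a b + fps_X ^ Suc a * G (Suc a) (b - 1)"
  shows "(\<Prod>i=1..a. 1 - fps_X ^ i) * G a b = stair_num a b"
proof (induction a b rule: stair_num.induct)
  case (1 a)
  show ?case
  proof (induction a)
    case (Suc a)
    have "(1 - fps_X ^ Suc a) * G (Suc a) 0 = G a 0"
      using assms(3)[of 0 a] by (simp add: algebra_simps)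
    then show ?case using Suc.IH by (simp add: mult.assoc)
  qed (simp add: zero)
next
  case (2 b)
  then show ?case by (simp add: empty)
next
  case (3 a b)
  show ?case
  proof (cases "a < b")
    case False
    let ?E = "\<lambda>a. \<Prod>i=1..a. (1 :: int fps) - fps_X ^ i"
    have "?E (Suc a) * G (Suc a) (Suc b) =
        (1 - fps_X ^ Suc a) * (?E a * G a (Suc b)) + fps_X ^ Suc a * (?E (Suc a) * G (Suc a) b)"
      using False Suc[of "Suc b" a] by (simp add: algebra_simps)
    with 3 False show ?thesis by simp
  qed (simp add: empty)
qed

lemma gf_padded:
  "(\<Prod>i=1..a. 1 - fps_X ^ i) * gf sum_list (padded a b) = stair_num a b"
proof (rule stair_num_unique)
  show "gf sum_list (padded (Suc a) b) =
      gf sum_list (padded a b) + fps_X ^ Suc a * gf sum_list (padded (Suc a) (b - 1))"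
    if "b \<le> Suc a" for a b
    using that by (rule gf_padded_Suc)
qed (simp_all add: padded_0 padded_empty fps_eq_iff gf_nth Collect_conv_if)

lemma gf_bounded:
  "(\<Prod>i=1..a. 1 - fps_X ^ i) * gf sum_list (bounded a b) = stair_num a b"
proof (rule stair_num_unique)
  show "gf sum_list (bounded (Suc a) b) =
      gf sum_list (bounded a b) + fps_X ^ Suc a * gf sum_list (bounded (Suc a) (b - 1))"
    if "b \<le> Suc a" for a b
    using that by (rule gf_bounded_Suc)
qed (simp_all add: bounded_0 bounded_empty fps_eq_iff gf_nth Collect_conv_if)


section \<open>Splitting a partition at its critical row\<close>

text \<open>The partitions, of any size, with max-rook number \<open>k\<close>.\<close>

definition rook_set :: "nat \<Rightarrow> nat list set" where
  "rook_set k = {ls. sorted_wrt (\<ge>) ls \<and> (\<forall>l\<in>set ls. 0 < l) \<and>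
     staircase k ls \<and> \<not> staircase (Suc k) ls}"

text \<open>The inverse of cutting at row \<open>i\<close>: the rows of \<open>t\<close> are put to the right of a
  rectangle with \<open>i\<close> rows and \<open>k + 1 - i\<close> columns, and \<open>u\<close> is put below it.
  Zero entries of \<open>t\<close> become positive parts because \<open>k + 1 - i > 0\<close>.\<close>

definition glue :: "nat \<Rightarrow> nat \<Rightarrow> nat list \<times> nat list \<Rightarrow> nat list" where
  "glue k i = (\<lambda>(t, u). map (\<lambda>x. x + (k + 1 - i)) t @ u)"

lemma rook_count_eq: "int (rook_count k n) = gf sum_list (rook_set k) $ n"
proof -
  have "ls \<in> partitions n \<and> max_rook ls = k \<longleftrightarrow> ls \<in> rook_set k \<and> sum_list ls = n" for ls
    using max_rook_eq_iff[of ls k] by (auto simp: partitions_def rook_set_def)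
  then have "{ls \<in> partitions n. max_rook ls = k} = {ls \<in> rook_set k. sum_list ls = n}"
    by blast
  then show ?thesis by (simp add: rook_count_def gf_nth)
qed

lemma fin_weight_rook_set: "fin_weight sum_list (rook_set k)"
  unfolding fin_weight_def
  by (intro allI finite_subset[OF _ finite_partitions])
    (auto simp: rook_set_def partitions_def)

lemma row_glue:
  assumes "length t = i"
  shows "row (glue k i (t, u)) l = (if l < i then t ! l + (k + 1 - i) else row u (l - i))"
  using assms by (simp add: glue_def row_append)

text \<open>In a glued partition the row \<open>i\<close> is the first one with \<open>i + \<lambda>\<^sub>i \<le> k\<close>. This
  determines \<open>i\<close> and makes the images for different \<open>i\<close> disjoint.\<close>

lemma glue_critical:
  assumes "i \<le> k" "t \<in> padded i i" "u \<in> bounded (k - i) (k - i)"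
  shows "i + row (glue k i (t, u)) i \<le> k"
    and "l < i \<Longrightarrow> k < l + row (glue k i (t, u)) l"
proof -
  have len: "length t = i" using assms(2) by (simp add: padded_def)
  have "row u 0 \<le> k - i"
    using assms(3) by (cases u) (auto simp: bounded_def row_def)
  with assms(1) show "i + row (glue k i (t, u)) i \<le> k"
    by (simp add: row_glue[OF len])
  assume "l < i"
  then have "i \<le> l + t ! l" using assms(2) by (auto simp: padded_def staircase_def row_def)
  with \<open>l < i\<close> assms(1) show "k < l + row (glue k i (t, u)) l"
    by (simp add: row_glue[OF len])
qed

lemma glue_in_rook_set:
  assumes "i \<le> k" "t \<in> padded i i" "u \<in> bounded (k - i) (k - i)"
  shows "glue k i (t, u) \<in> rook_set k"
proof -
  have len: "length t = i" using assms(2) by (simp add: padded_def)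
  have "sorted_wrt (\<ge>) (glue k i (t, u))"
  proof -
    have "y \<le> x + (k + 1 - i)" if "y \<in> set u" for x y
    proof -
      have "y \<le> k - i" using assms(3) that by (simp add: bounded_def)
      then show ?thesis by simp
    qed
    then show ?thesis
      using assms(2,3) by (simp add: glue_def padded_def bounded_def sorted_wrt_append sorted_wrt_map)
  qed
  moreover have "\<forall>l\<in>set (glue k i (t, u)). 0 < l"
    using assms by (auto simp: glue_def bounded_def)
  moreover have "staircase k (glue k i (t, u))"
    unfolding staircase_def
  proof (intro allI impI)
    fix l assume "l < k"
    show "k \<le> l + row (glue k i (t, u)) l"
    proof (cases "l < i")
      case True
      with glue_critical(2)[OF assms] show ?thesis by (simp add: less_imp_le)
    next
      case False
      have "staircase (k - i) u" using assms(3) by (simp add: bounded_def)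
      moreover have "l - i < k - i" using False \<open>l < k\<close> by simp
      ultimately have "k - i \<le> (l - i) + row u (l - i)" unfolding staircase_def by blast
      with False show ?thesis by (simp add: row_glue[OF len])
    qed
  qed
  moreover have "\<not> staircase (Suc k) (glue k i (t, u))"
    using glue_critical(1)[OF assms] assms(1)
    by (auto simp: staircase_def intro!: exI[of _ i])
  ultimately show ?thesis by (simp add: rook_set_def)
qed

lemma rook_set_split:
  assumes "ls \<in> rook_set k"
  shows "\<exists>i\<le>k. ls \<in> glue k i ` (padded i i \<times> bounded (k - i) (k - i))"
proof -
  have sorted: "sorted_wrt (\<ge>) ls" and pos: "\<forall>l\<in>set ls. 0 < l"
    and stair: "staircase k ls" and "\<not> staircase (Suc k) ls"
    using assms by (auto simp: rook_set_def)
  then have ex: "\<exists>i. i + row ls i \<le> k" by (auto simp: staircase_def not_le less_Suc_eq_le)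
  \<comment> \<open>The critical row.\<close>
  define i where "i = (LEAST i. i + row ls i \<le> k)"
  have crit: "i + row ls i \<le> k" unfolding i_def by (rule LeastI_ex[OF ex])
  have above: "k < l + row ls l" if "l < i" for l
    using that not_less_Least[of l "\<lambda>i. i + row ls i \<le> k"] by (simp add: i_def not_le)
  have len: "i \<le> length ls" using crit staircase_length[OF stair] by simp
  define c where "c = k + 1 - i"
  define t where "t = map (\<lambda>x. x - c) (take i ls)"
  define u where "u = drop i ls"
  have big: "k + 1 - l \<le> ls ! l" if "l < i" for l
    using above[OF that] that len by (simp add: row_def)
  have "length t = i" using len by (simp add: t_def)
  have "t \<in> padded i i"
  proof -
    have "sorted_wrt (\<ge>) t"
      using sorted len by (auto simp: t_def sorted_wrt_iff_nth_less diff_le_mono)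
    moreover have "staircase i t"
      unfolding staircase_def
    proof (intro allI impI)
      fix l assume "l < i"
      with big[OF this] crit len show "i \<le> l + row t l"
        by (simp add: t_def row_def c_def)
    qed
    ultimately show ?thesis using \<open>length t = i\<close> by (simp add: padded_def)
  qed
  moreover have "u \<in> bounded (k - i) (k - i)"
  proof -
    have row_u: "row u m = row ls (i + m)" for m
      using len by (auto simp: u_def row_def)
    have "x \<le> k - i" if "x \<in> set u" for x
    proof -
      obtain m where "m < length u" "x = u ! m" using \<open>x \<in> set u\<close> by (metis in_set_conv_nth)
      then have "x = row ls (i + m)" using row_u[of m] by (simp add: row_def)
      also have "\<dots> \<le> row ls i" by (rule row_antimono[OF sorted]) simp
      finally show ?thesis using crit by simp
    qed
    moreover have "staircase (k - i) u"
      unfolding staircase_def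
    proof (intro allI impI)
      fix m assume "m < k - i"
      then have "k \<le> (i + m) + row ls (i + m)" using stair by (simp add: staircase_def)
      then show "k - i \<le> m + row u m" by (simp add: row_u)
    qed
    moreover have "sorted_wrt (\<ge>) u" using sorted by (simp add: u_def sorted_wrt_drop)
    ultimately show ?thesis using pos by (auto simp: bounded_def u_def dest: in_set_dropD)
  qed
  moreover have "ls = glue k i (t, u)"
  proof -
    have "map (\<lambda>x. x + c) t = take i ls"
      unfolding t_def map_map
    proof (rule map_idI)
      fix x assume "x \<in> set (take i ls)"
      then obtain l where "l < i" "x = ls ! l" by (auto simp: in_set_conv_nth)
      with big[of l] show "((\<lambda>x. x + c) \<circ> (\<lambda>x. x - c)) x = x" by (simp add: c_def)
    qed
    then show ?thesis by (simp add: glue_def u_def c_def)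
  qed
  ultimately show ?thesis using crit by (intro exI[of _ i]) auto
qed

lemma gf_rook_set:
  "gf sum_list (rook_set k) = (\<Sum>i\<le>k. fps_X ^ (i * (k + 1 - i)) *
     (gf sum_list (padded i i) * gf sum_list (bounded (k - i) (k - i))))"
proof -
  let ?P = "\<lambda>i. padded i i \<times> bounded (k - i) (k - i)"
  let ?A = "\<lambda>i. glue k i ` ?P i"
  have eq: "rook_set k = (\<Union>i\<in>{..k}. ?A i)"
    using rook_set_split glue_in_rook_set by fastforce
  have "disjoint_family_on ?A {..k}"
  proof -
    have False if ij: "i < j" "j \<le> k" and "ls \<in> ?A i" "ls \<in> ?A j" for i j ls
    proof -
      have "i + row ls i \<le> k" using that glue_critical(1)[of i k] by auto
      moreover have "k < i + row ls i" using that glue_critical(2)[of j k] by auto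
      ultimately show False by simp
    qed
    then show ?thesis
      unfolding disjoint_family_on_def by (metis atMost_iff disjoint_iff nat_neq_iff)
  qed
  then have "gf sum_list (rook_set k) = (\<Sum>i\<le>k. gf sum_list (?A i))"
    unfolding eq using fin_weight_rook_set[of k] eq by (intro gf_UN_disjoint) simp_all
  also have "\<dots> = (\<Sum>i\<le>k. fps_X ^ (i * (k + 1 - i)) *
      gf (\<lambda>(t, u). sum_list t + sum_list u) (?P i))"
  proof (intro sum.cong refl gf_image)
    fix i
    show "inj_on (glue k i) (?P i)"
    proof (rule inj_onI)
      fix y z assume yz: "y \<in> ?P i" "z \<in> ?P i" "glue k i y = glue k i z"
      obtain t u t' u' where tu: "y = (t, u)" "z = (t', u')" by (cases y, cases z)
      have "inj (map (\<lambda>x::nat. x + (k + 1 - i)))" by (intro inj_mapI) (simp add: inj_def)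
      moreover have "length t = length t'" using yz tu by (simp add: padded_def)
      ultimately show "y = z" using yz(3) by (simp add: tu glue_def inj_eq)
    qed
    fix z assume "z \<in> ?P i"
    then obtain t u where z: "z = (t, u)" "length t = i" by (auto simp: padded_def)
    have "sum_list (map (\<lambda>x. x + c) t) = sum_list t + length t * c" for c
      by (induction t) simp_all
    with z show "sum_list (glue k i z) =
        (case z of (t, u) \<Rightarrow> sum_list t + sum_list u) + i * (k + 1 - i)"
      by (simp add: glue_def)
  qed
  also have "\<dots> = (\<Sum>i\<le>k. fps_X ^ (i * (k + 1 - i)) *
     (gf sum_list (padded i i) * gf sum_list (bounded (k - i) (k - i))))"
    by (simp add: gf_Times fin_weight_padded fin_weight_bounded)
  finally show ?thesis .
qed

section \<open>Max-rook number four\<close>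

lemma stair_num_rec:
  assumes "0 < b" "b \<le> a"
  shows "stair_num a b = (1 - fps_X ^ a) * stair_num (a - 1) b + fps_X ^ a * stair_num a (b - 1)"
  using assms by (cases a; cases b) (simp_all del: power_Suc)

lemma stair_num_eq_0: "a < b \<Longrightarrow> stair_num a b = 0"
  by (induction a b rule: stair_num.induct) auto

lemma stair_num_1_1: "stair_num 1 (Suc 0) = fps_X"
  using stair_num_rec[of "Suc 0" 1]
  by (simp add: stair_num_eq_0 algebra_simps flip: power_add power_Suc)

lemma stair_num_2_1: "stair_num 2 (Suc 0) = fps_X + fps_X ^ 2 - fps_X ^ 3"
  using stair_num_rec[of "Suc 0" 2]
  by (simp add: stair_num_1_1 algebra_simps flip: power_add power_Suc)

lemma stair_num_2_2: "stair_num 2 2 = fps_X ^ 3 + fps_X ^ 4 - fps_X ^ 5"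
  using stair_num_rec[of 2 2]
  by (simp add: stair_num_eq_0 stair_num_2_1 algebra_simps flip: power_add power_Suc)

lemma stair_num_3_1: "stair_num 3 (Suc 0) = fps_X + fps_X ^ 2 - fps_X ^ 4 - fps_X ^ 5
    + fps_X ^ 6"
  using stair_num_rec[of "Suc 0" 3]
  by (simp add: stair_num_2_1 algebra_simps flip: power_add power_Suc)

lemma stair_num_3_2: "stair_num 3 2 = fps_X ^ 3 + 2 * fps_X ^ 4 - fps_X ^ 6 - 2 * fps_X ^ 7 +
    fps_X ^ 9"
  using stair_num_rec[of 2 3]
  by (simp add: stair_num_2_2 stair_num_3_1 algebra_simps flip: power_add power_Suc)

lemma stair_num_3_3: "stair_num 3 3 = fps_X ^ 6 + 2 * fps_X ^ 7 - fps_X ^ 9 - 2 * fps_X ^ 10 +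
    fps_X ^ 12"
  using stair_num_rec[of 3 3]
  by (simp add: stair_num_eq_0 stair_num_3_2 algebra_simps flip: power_add power_Suc)

lemma stair_num_4_1: "stair_num 4 (Suc 0) = fps_X + fps_X ^ 2 - 2 * fps_X ^ 5 + fps_X ^ 8
    + fps_X ^ 9 - fps_X ^ 10"
  using stair_num_rec[of "Suc 0" 4]
  by (simp add: stair_num_3_1 algebra_simps flip: power_add power_Suc)

lemma stair_num_4_2: "stair_num 4 2 = fps_X ^ 3 + 2 * fps_X ^ 4 + fps_X ^ 5 - 3 * fps_X ^ 7
    - 2 * fps_X ^ 8 - fps_X ^ 9 + fps_X ^ 10 + 2 * fps_X ^ 11 + fps_X ^ 12 - fps_X ^ 14"
  using stair_num_rec[of 2 4]
  by (simp add: stair_num_3_2 stair_num_4_1 algebra_simps flip: power_add power_Suc)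

lemma stair_num_4_3: "stair_num 4 3 = fps_X ^ 6 + 3 * fps_X ^ 7 + 2 * fps_X ^ 8 - 3 * fps_X ^ 10
    - 5 * fps_X ^ 11 - fps_X ^ 12 + 3 * fps_X ^ 14 + 2 * fps_X ^ 15 - fps_X ^ 18"
  using stair_num_rec[of 3 4]
  by (simp add: stair_num_3_3 stair_num_4_2 algebra_simps flip: power_add power_Suc)

lemma stair_num_4_4: "stair_num 4 4 = fps_X ^ 10 + 3 * fps_X ^ 11 + 2 * fps_X ^ 12
    - 3 * fps_X ^ 14 - 5 * fps_X ^ 15 - fps_X ^ 16 + 3 * fps_X ^ 18 + 2 * fps_X ^ 19
    - fps_X ^ 22"
  using stair_num_rec[of 4 4]
  by (simp add: stair_num_eq_0 stair_num_4_3 algebra_simps flip: power_add power_Suc)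

text \<open>Multiplying by the full denominator leaves, for each \<open>i\<close>, the product of two numerators
  with the Gaussian binomial coefficient of 4 over \<open>i\<close>.\<close>

lemma gf_rook_set_4:
  "(1 - fps_X) * (1 - fps_X ^ 2) * (1 - fps_X ^ 3) * (1 - fps_X ^ 4) * gf sum_list (rook_set 4) =
    fps_X ^ 10 + 4 * fps_X ^ 11 + 6 * fps_X ^ 12 + 7 * fps_X ^ 13 + 6 * fps_X ^ 14
    + 2 * fps_X ^ 15 - 5 * fps_X ^ 17 - 5 * fps_X ^ 18 - 5 * fps_X ^ 19 + fps_X ^ 21
    + 3 * fps_X ^ 22 + 2 * fps_X ^ 23 - fps_X ^ 26"
proof -
  define P where "P i = gf sum_list (padded i i)" for i
  define B where "B i = gf sum_list (bounded i i)" for i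
  let ?x = "fps_X :: int fps"
  have E: "(\<Prod>i=1..1. 1 - ?x ^ i) = 1 - ?x"
    "(\<Prod>i=1..2. 1 - ?x ^ i) = (1 - ?x) * (1 - ?x ^ 2)"
    "(\<Prod>i=1..3. 1 - ?x ^ i) = (1 - ?x) * (1 - ?x ^ 2) * (1 - ?x ^ 3)"
    "(\<Prod>i=1..4. 1 - ?x ^ i) = (1 - ?x) * (1 - ?x ^ 2) * (1 - ?x ^ 3) * (1 - ?x ^ 4)"
    by (simp_all add: numeral_eq_Suc del: power_Suc)
  have P0: "P 0 = 1" and B0: "B 0 = 1"
    using gf_padded[of 0 0] gf_bounded[of 0 0] by (simp_all add: P_def B_def)
  note P = gf_padded[of 1 1] gf_padded[of 2 2] gf_padded[of 3 3] gf_padded[of 4 4]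
  note P = P[folded P_def, unfolded E stair_num_1_1[folded One_nat_def]
      stair_num_2_2 stair_num_3_3 stair_num_4_4]
  note B = gf_bounded[of 1 1] gf_bounded[of 2 2] gf_bounded[of 3 3] gf_bounded[of 4 4]
  note B = B[folded B_def, unfolded E stair_num_1_1[folded One_nat_def]
      stair_num_2_2 stair_num_3_3 stair_num_4_4]
  have "{..4::nat} = {0, 1, 2, 3, 4}" by auto
  then have sum: "gf sum_list (rook_set 4) =
      B 4 + ?x ^ 4 * (P 1 * B 3) + ?x ^ 6 * (P 2 * B 2) + ?x ^ 6 * (P 3 * B 1) + ?x ^ 4 * P 4"
    using gf_rook_set[of 4] P0 B0 by (simp add: P_def B_def)
  have "(1 - ?x) * (1 - ?x ^ 2) * (1 - ?x ^ 3) * (1 - ?x ^ 4) * gf sum_list (rook_set 4) =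
      (1 - ?x) * (1 - ?x ^ 2) * (1 - ?x ^ 3) * (1 - ?x ^ 4) * B 4 +
      ?x ^ 4 * (1 + ?x + ?x ^ 2 + ?x ^ 3) *
        (((1 - ?x) * P 1) * ((1 - ?x) * (1 - ?x ^ 2) * (1 - ?x ^ 3) * B 3)) +
      ?x ^ 6 * (1 + ?x + 2 * ?x ^ 2 + ?x ^ 3 + ?x ^ 4) *
        (((1 - ?x) * (1 - ?x ^ 2) * P 2) * ((1 - ?x) * (1 - ?x ^ 2) * B 2)) +
      ?x ^ 6 * (1 + ?x + ?x ^ 2 + ?x ^ 3) *
        (((1 - ?x) * (1 - ?x ^ 2) * (1 - ?x ^ 3) * P 3) * ((1 - ?x) * B 1)) +
      ?x ^ 4 * ((1 - ?x) * (1 - ?x ^ 2) * (1 - ?x ^ 3) * (1 - ?x ^ 4) * P 4)"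
    unfolding sum by algebra
  also have "\<dots> = fps_X ^ 10 + 4 * fps_X ^ 11 + 6 * fps_X ^ 12 + 7 * fps_X ^ 13
      + 6 * fps_X ^ 14 + 2 * fps_X ^ 15 - 5 * fps_X ^ 17 - 5 * fps_X ^ 18 - 5 * fps_X ^ 19
      + fps_X ^ 21 + 3 * fps_X ^ 22 + 2 * fps_X ^ 23 - fps_X ^ 26"
    unfolding P B by algebra
  finally show ?thesis .
qed

text \<open>The subtracted polynomial collects the values of \<open>R\<^sub>4(n)\<close> for \<open>n \<le> 26\<close>. That
  the right-hand side is divisible by \<open>q\<^bsup>27\<^esup>\<close> confirms all of these values at once, since
  the denominator has a nonzero constant term.\<close>

lemma gf_rook_set_4_tail:
  "(1 - fps_X) * (1 - fps_X ^ 2) * (1 - fps_X ^ 3) * (1 - fps_X ^ 4) * (gf sum_list (rook_set 4) -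
      (fps_X ^ 10 + 5 * fps_X ^ 11 + 12 * fps_X ^ 12 + 24 * fps_X ^ 13 + 42 * fps_X ^ 14
       + 66 * fps_X ^ 15 + 98 * fps_X ^ 16 + 135 * fps_X ^ 17 + 181 * fps_X ^ 18
       + 233 * fps_X ^ 19 + 298 * fps_X ^ 20 + 367 * fps_X ^ 21 + 452 * fps_X ^ 22
       + 543 * fps_X ^ 23 + 651 * fps_X ^ 24 + 765 * fps_X ^ 25 + 899 * fps_X ^ 26)) =
    fps_X ^ 27 * (1039 + 163 * fps_X - 870 * fps_X ^ 2 - 1009 * fps_X ^ 3 - 1170 * fps_X ^ 4
                  + 742 * fps_X ^ 5 + 873 * fps_X ^ 6 + 1013 * fps_X ^ 7 + 134 * fps_X ^ 8
                  - 899 * fps_X ^ 9)"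
  (is "?E * (?F - ?S) = ?V")
proof -
  have "?E * (?F - ?S) = ?E * ?F - ?E * ?S" by (rule right_diff_distrib)
  also have "\<dots> = ?V" unfolding gf_rook_set_4 by algebra
  finally show ?thesis .
qed

lemma fps_nth_eq_0_if_mult_eq:
  fixes E G V :: "'a :: idom fps"
  assumes "E $ 0 \<noteq> 0" "E * G = fps_X ^ k * V" "n < k"
  shows "G $ n = 0"
proof (cases "G = 0")
  case False
  have "E \<noteq> 0" using assms(1) by auto
  with False assms(2) have "V \<noteq> 0" by auto
  have "subdegree G = subdegree (E * G)"
    using assms(1) False \<open>E \<noteq> 0\<close> by (simp add: subdegree_mult)
  also have "\<dots> = k + subdegree V"
    unfolding assms(2) using \<open>V \<noteq> 0\<close> by (simp add: subdegree_mult fps_X_power_subdegree)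
  finally show ?thesis using assms(3) by (intro nth_less_subdegree_zero) simp
qed simp

lemma fps_numeral_mult_nth: "(numeral k * f) $ n = numeral k * (f $ n)"
  for f :: "'a :: comm_ring_1 fps"
  by (simp add: numeral_fps_const)

lemma rook_count_4_small:
  assumes "n < 27"
  shows "int (rook_count 4 n) =
    (fps_X ^ 10 + 5 * fps_X ^ 11 + 12 * fps_X ^ 12 + 24 * fps_X ^ 13 + 42 * fps_X ^ 14
     + 66 * fps_X ^ 15 + 98 * fps_X ^ 16 + 135 * fps_X ^ 17 + 181 * fps_X ^ 18
     + 233 * fps_X ^ 19 + 298 * fps_X ^ 20 + 367 * fps_X ^ 21 + 452 * fps_X ^ 22
     + 543 * fps_X ^ 23 + 651 * fps_X ^ 24 + 765 * fps_X ^ 25 + 899 * fps_X ^ 26) $ n"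
    (is "_ = ?S $ n")
proof -
  let ?E = "(1 - fps_X) * (1 - fps_X ^ 2) * (1 - fps_X ^ 3) * (1 - fps_X ^ 4) :: int fps"
  let ?F = "gf sum_list (rook_set 4)"
  have "?E $ 0 \<noteq> 0" by simp
  then have "(?F - ?S) $ n = 0"
    using gf_rook_set_4_tail assms by (rule fps_nth_eq_0_if_mult_eq)
  then show ?thesis by (simp only: rook_count_eq fps_sub_nth right_minus_eq)
qed

lemma rook_count_4_rec:
  assumes "27 \<le> n"
  shows "int (rook_count 4 n) =
    int (rook_count 4 (n - 1)) + int (rook_count 4 (n - 2)) - 2 * int (rook_count 4 (n - 5)) +
    int (rook_count 4 (n - 8)) + int (rook_count 4 (n - 9)) - int (rook_count 4 (n - 10))"
proof -
  let ?F = "gf sum_list (rook_set 4)" and ?x = "fps_X :: int fps"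
  have expand: "?F - ?x ^ 1 * ?F - ?x ^ 2 * ?F + 2 * (?x ^ 5 * ?F) - ?x ^ 8 * ?F - ?x ^ 9 * ?F +
      ?x ^ 10 * ?F = (1 - ?x) * (1 - ?x ^ 2) * (1 - ?x ^ 3) * (1 - ?x ^ 4) * ?F"
    by algebra
  have "(?F - ?x ^ 1 * ?F - ?x ^ 2 * ?F + 2 * (?x ^ 5 * ?F) - ?x ^ 8 * ?F - ?x ^ 9 * ?F +
      ?x ^ 10 * ?F) $ n = 0"
    unfolding expand gf_rook_set_4 using assms
    by (simp add: fps_numeral_mult_nth fps_X_power_nth)
  then show ?thesis
    using assms by (simp add: rook_count_eq fps_numeral_mult_nth fps_X_power_mult_nth)
qed


section \<open>The quasi-polynomial\<close>

text \<open>The value at \<open>n = 12 m + a\<close> of the quasi-polynomial, for \<open>a < 12\<close>. The twelve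
  polynomials share the cubic coefficient, and the quadratic one is affine in \<open>a\<close>; the lists
  give the remaining two coefficients.\<close>

definition rook_poly :: "nat \<Rightarrow> int \<Rightarrow> int" where
  "rook_poly a m = 192 * m ^ 3 + (48 * int a - 264) * m ^ 2 +
     [87, 44, 15, -12, -25, -36, -33, -28, -9, 12, 47, 84] ! a * m +
     [-3, 5, 5, 7, 4, 3, -2, -3, -5, -5, -3, 3] ! a"

definition rook_quasi_poly :: "nat \<Rightarrow> int" where
  "rook_quasi_poly n = rook_poly (n mod 12) (int (n div 12))"

text \<open>Since \<open>n - 10\<close> may lie in the period before that of \<open>n\<close>, the proof writes
  \<open>n = 12 m + c\<close> with \<open>12 \<le> c < 24\<close>. All arguments are then \<open>12 m + d\<close> with
  \<open>d < 24\<close>, and each \<open>c\<close> gives an identity between cubic polynomials in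
  \<open>m\<close>.\<close>

lemma rook_quasi_poly_rec:
  assumes "12 \<le> n"
  shows "rook_quasi_poly n =
    rook_quasi_poly (n - 1) + rook_quasi_poly (n - 2) - 2 * rook_quasi_poly (n - 5) +
    rook_quasi_poly (n - 8) + rook_quasi_poly (n - 9) - rook_quasi_poly (n - 10)"
proof -
  have shift: "rook_quasi_poly (12 * m + d) =
      (if d < 12 then rook_poly d (int m) else rook_poly (d - 12) (int m + 1))"
    if "d < 24" for m d
  proof (cases "d < 12")
    case False
    then obtain e where e: "d = e + 12" "e < 12"
      using \<open>d < 24\<close> by (intro that[of "d - 12"]) auto
    then have "12 * m + d = 12 * Suc m + e" by simp
    then have "rook_quasi_poly (12 * m + d) = rook_poly e (int (Suc m))"
      using e by (simp add: rook_quasi_poly_def del: mult_Suc_right)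
    with e show ?thesis by (simp add: add.commute)
  qed (simp add: rook_quasi_poly_def)
  define m where "m = n div 12 - 1"
  define c where "c = n - 12 * m"
  have n: "n = 12 * m + c" and c: "12 \<le> c" "c < 24"
    using assms unfolding m_def c_def by linarith+
  have val: "rook_quasi_poly (n - j) =
      (if c - j < 12 then rook_poly (c - j) (int m) else rook_poly (c - j - 12) (int m + 1))"
    if "j \<le> 12" for j
  proof -
    have "n - j = 12 * m + (c - j)" using n c that by simp
    then show ?thesis using shift[of "c - j" m] c by simp
  qed
  have val0: "rook_quasi_poly n = rook_poly (c - 12) (int m + 1)"
    using val[of 0] c by simp
  have "c \<in> {12, 13, 14, 15, 16, 17, 18, 19, 20, 21, 22, 23}"
    using c unfolding insert_iff empty_iff by presburger
  then show ?thesis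
    unfolding val0 using c val[of 1] val[of 2] val[of 5] val[of 8] val[of 9] val[of 10]
    by (elim insertE emptyE)
      (simp_all add: rook_poly_def power2_eq_square power3_eq_cube algebra_simps)
qed

lemma rook_count_4:
  assumes "16 < n"
  shows "int (rook_count 4 n) = rook_quasi_poly n"
  using assms
proof (induction n rule: less_induct)
  case (less n)
  show ?case
  proof (cases "n < 27")
    case True
    then have "n \<in> {17, 18, 19, 20, 21, 22, 23, 24, 25, 26}"
      using less.prems unfolding insert_iff empty_iff by presburger
    then show ?thesis
      using rook_count_4_small[OF True]
      by (elim insertE emptyE)
        (simp_all add: fps_numeral_mult_nth fps_X_power_nth rook_quasi_poly_def rook_poly_def)
  next
    case False
    then show ?thesis
      using less.IH rook_count_4_rec[of n] rook_quasi_poly_rec[of n] by simp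
  qed
qed

lemma rook_poly_cong:
  "[rook_poly a (m + p) = rook_poly a m] (mod p)"
proof -
  have "[m + p = m] (mod p)" by (simp add: cong_def)
  then show ?thesis
    unfolding rook_poly_def by (intro cong_add cong_mult cong_pow cong_refl \<open>[m + p = m] (mod p)\<close>)
qed

theorem theorem4p3:
  shows "(\<forall>(n::nat) (m::int) (a::int).
       16 < n \<and> int n = 12 * m + a \<and> 0 \<le> a \<and> a \<le> 11 \<longrightarrow>
         (a = 0 \<longrightarrow> int (rook_count 4 n) = 192 * m^3 - 264 * m^2 + 87 * m - 3) \<and>
         (a = 1 \<longrightarrow> int (rook_count 4 n) = 192 * m^3 - 216 * m^2 + 44 * m + 5) \<and>
         (a = 2 \<longrightarrow> int (rook_count 4 n) = 192 * m^3 - 168 * m^2 + 15 * m + 5) \<and>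
         (a = 3 \<longrightarrow> int (rook_count 4 n) = 192 * m^3 - 120 * m^2 - 12 * m + 7) \<and>
         (a = 4 \<longrightarrow> int (rook_count 4 n) = 192 * m^3 - 72 * m^2 - 25 * m + 4) \<and>
         (a = 5 \<longrightarrow> int (rook_count 4 n) = 192 * m^3 - 24 * m^2 - 36 * m + 3) \<and>
         (a = 6 \<longrightarrow> int (rook_count 4 n) = 192 * m^3 + 24 * m^2 - 33 * m - 2) \<and>
         (a = 7 \<longrightarrow> int (rook_count 4 n) = 192 * m^3 + 72 * m^2 - 28 * m - 3) \<and>
         (a = 8 \<longrightarrow> int (rook_count 4 n) = 192 * m^3 + 120 * m^2 - 9 * m - 5) \<and>
         (a = 9 \<longrightarrow> int (rook_count 4 n) = 192 * m^3 + 168 * m^2 + 12 * m - 5) \<and>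
         (a = 10 \<longrightarrow> int (rook_count 4 n) = 192 * m^3 + 216 * m^2 + 47 * m - 3) \<and>
         (a = 11 \<longrightarrow> int (rook_count 4 n) = 192 * m^3 + 264 * m^2 + 84 * m + 3))
     \<and> (\<forall>p::nat. 2 \<le> p \<longrightarrow>
           (\<forall>n::nat. 16 < n \<longrightarrow>
              [rook_count 4 (n + 12 * p) = rook_count 4 n] (mod p)))"
proof (rule conjI; intro allI impI)
  fix n :: nat and m a :: int
  assume n: "16 < n \<and> int n = 12 * m + a \<and> 0 \<le> a \<and> a \<le> 11"
  have div: "int (n div 12) = m"
  proof -
    have "int (n div 12) = (12 * m + a) div 12" using n by (simp add: zdiv_int)
    with n show ?thesis by simp
  qed
  have mod: "int (n mod 12) = a"
  proof -
    have "int (n mod 12) = (12 * m + a) mod 12" using n by (simp add: zmod_int)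
    with n show ?thesis by simp
  qed
  have "nat a = n mod 12" unfolding mod[symmetric] by simp
  then have "int (rook_count 4 n) = rook_poly (nat a) m"
    using n div rook_count_4[of n]
    by (simp add: rook_quasi_poly_def)
  then show "(a = 0 \<longrightarrow> int (rook_count 4 n) = 192 * m^3 - 264 * m^2 + 87 * m - 3) \<and>
         (a = 1 \<longrightarrow> int (rook_count 4 n) = 192 * m^3 - 216 * m^2 + 44 * m + 5) \<and>
         (a = 2 \<longrightarrow> int (rook_count 4 n) = 192 * m^3 - 168 * m^2 + 15 * m + 5) \<and>
         (a = 3 \<longrightarrow> int (rook_count 4 n) = 192 * m^3 - 120 * m^2 - 12 * m + 7) \<and>
         (a = 4 \<longrightarrow> int (rook_count 4 n) = 192 * m^3 - 72 * m^2 - 25 * m + 4) \<and>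
         (a = 5 \<longrightarrow> int (rook_count 4 n) = 192 * m^3 - 24 * m^2 - 36 * m + 3) \<and>
         (a = 6 \<longrightarrow> int (rook_count 4 n) = 192 * m^3 + 24 * m^2 - 33 * m - 2) \<and>
         (a = 7 \<longrightarrow> int (rook_count 4 n) = 192 * m^3 + 72 * m^2 - 28 * m - 3) \<and>
         (a = 8 \<longrightarrow> int (rook_count 4 n) = 192 * m^3 + 120 * m^2 - 9 * m - 5) \<and>
         (a = 9 \<longrightarrow> int (rook_count 4 n) = 192 * m^3 + 168 * m^2 + 12 * m - 5) \<and>
         (a = 10 \<longrightarrow> int (rook_count 4 n) = 192 * m^3 + 216 * m^2 + 47 * m - 3) \<and>
         (a = 11 \<longrightarrow> int (rook_count 4 n) = 192 * m^3 + 264 * m^2 + 84 * m + 3)"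
    by (intro conjI impI) (simp_all add: rook_poly_def)
next
  fix p n :: nat
  assume "2 \<le> p" "16 < n"
  have "int (rook_count 4 (n + 12 * p)) = rook_poly (n mod 12) (int (n div 12) + int p)"
    using rook_count_4[of "n + 12 * p"] \<open>16 < n\<close> by (simp add: rook_quasi_poly_def add.commute)
  moreover have "int (rook_count 4 n) = rook_poly (n mod 12) (int (n div 12))"
    using rook_count_4[of n] \<open>16 < n\<close> by (simp add: rook_quasi_poly_def)
  ultimately have "[int (rook_count 4 (n + 12 * p)) = int (rook_count 4 n)] (mod int p)"
    by (simp add: rook_poly_cong)
  then show "[rook_count 4 (n + 12 * p) = rook_count 4 n] (mod p)"
    by (simp add: cong_int_iff)
qed

end
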